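(* Let $p$ be a prime number and $h\in\mathbb{N}$. When $p=2$, suppose in addition that $h\geq 3$. Let $M$ be a positive integer, and consider a set $\mathcal{M}$ of $r$ integers in the interval $[M,2M)$. Write $W=\left\lfloor \phi(p^h)/(h+1)\right\rfloor$. Suppose that there is a non-zero solution $\mathbf{x}=(x_{il})_{1\leq i\leq s,\ 0\leq l\leq W-1}\in\mathbb{Q}_p^{Ws}$ to the system of equations $$\sum_{l=0}^{W-1}p^{l(h+1)M}S_{h,m}(x_{1l},\ldots,x_{sl})=0\quad\text{for all } m\in\mathcal{M}.$$ Then one has $s\geq p^{rh}$.
   Context: Here $\mathbb{N}$ is the set of positive integers, $\mathbb{Q}_p$ is the field of $p$-adic numbers, and $\phi(p^h)=p^{h-1}(p-1)$. For natural numbers $h$, $m$ and $N\geq 1$, one defines $$S_{h,m}(x_1,\ldots,x_N)=\sum_{i=1}^N x_i^{\phi(p^h)m}.$$ In the claim, $s$ is a natural number, and $S_{h,m}$ is used with $N=s$. *)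

theory Defs
  imports "HOL-Number_Theory.Totient" "HOL-Algebra.QuotRing"
begin

section \<open>The field of p-adic numbers\<close>

text \<open>
  The completion of the rationals with respect to the p-adic absolute value: the ring of p-adic
  Cauchy sequences modulo the ideal of p-adic null sequences.
\<close>

definition padic_abs :: "nat \<Rightarrow> rat \<Rightarrow> real" where
  "padic_abs p q = (case quotient_of q of (a, b) \<Rightarrow>
     if a = 0 then 0
     else real p powi (int (multiplicity (int p) b) - int (multiplicity (int p) a)))"

definition padic_Cauchy :: "nat \<Rightarrow> (nat \<Rightarrow> rat) \<Rightarrow> bool" where
  "padic_Cauchy p X \<longleftrightarrow> (\<forall>e>0. \<exists>K. \<forall>m\<ge>K. \<forall>n\<ge>K. padic_abs p (X m - X n) < e)"

definition padic_null :: "nat \<Rightarrow> (nat \<Rightarrow> rat) \<Rightarrow> bool" where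
  "padic_null p X \<longleftrightarrow> (\<forall>e>0. \<exists>K. \<forall>n\<ge>K. padic_abs p (X n) < e)"

definition padic_Cauchy_ring :: "nat \<Rightarrow> (nat \<Rightarrow> rat) ring" where
  "padic_Cauchy_ring p =
     \<lparr>carrier = {X. padic_Cauchy p X},
      mult = (\<lambda>X Y n. X n * Y n), one = (\<lambda>n. 1),
      zero = (\<lambda>n. 0), add = (\<lambda>X Y n. X n + Y n)\<rparr>"

type_synonym padic = "(nat \<Rightarrow> rat) set"

definition padic_field :: "nat \<Rightarrow> padic ring" where
  "padic_field p = padic_Cauchy_ring p Quot {X. padic_null p X}"


section \<open>The diagonal forms\<close>

definition diag_form ::
  "('a, 'b) ring_scheme \<Rightarrow> nat \<Rightarrow> nat \<Rightarrow> nat \<Rightarrow> nat \<Rightarrow> (nat \<Rightarrow> 'a) \<Rightarrow> 'a" where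
  "diag_form R p h m N x = (\<Oplus>\<^bsub>R\<^esub>i\<in>{1..N}. x i [^]\<^bsub>R\<^esub> (totient (p ^ h) * m))"


section \<open>The quotient is a field\<close>

lemma padic_abs_0 [simp]: "padic_abs p 0 = 0"
  by (simp add: padic_abs_def)

lemma padic_abs_divide:
  assumes p: "prime p" and "a \<noteq> 0" and "b \<noteq> 0"
  shows "padic_abs p (of_int a / of_int b) =
    real p powi (int (multiplicity (int p) b) - int (multiplicity (int p) a))"
proof -
  define q :: rat where "q = of_int a / of_int b"
  obtain c d where cd: "quotient_of q = (c, d)" by fastforce
  have d: "d > 0" using quotient_of_denom_pos[OF cd] .
  have q: "q = of_int c / of_int d" using quotient_of_div[OF cd] .
  have "q \<noteq> 0" using assms by (simp add: q_def)
  then have c: "c \<noteq> 0" using q by auto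
  have "of_int (a * d) = (of_int (c * b) :: rat)"
    using q d assms by (simp add: q_def field_simps)
  then have eq: "a * d = c * b" by (simp only: of_int_eq_iff)
  have pp: "prime_elem (int p)" using p by simp
  have "multiplicity (int p) (a * d) = multiplicity (int p) a + multiplicity (int p) d"
    "multiplicity (int p) (c * b) = multiplicity (int p) c + multiplicity (int p) b"
    using assms c d pp by (auto intro!: prime_elem_multiplicity_mult_distrib)
  then have "int (multiplicity (int p) d) - int (multiplicity (int p) c) =
      int (multiplicity (int p) b) - int (multiplicity (int p) a)"
    using eq by simp
  then show ?thesis
    unfolding q_def[symmetric] using cd c by (simp add: padic_abs_def)
qed

lemma nonzero_rat_cases:
  assumes "q \<noteq> (0 :: rat)"
  obtains a b :: int where "a \<noteq> 0" and "b > 0" and "q = of_int a / of_int b"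
proof -
  obtain c d where cd: "quotient_of q = (c, d)" by fastforce
  have "d > 0" using quotient_of_denom_pos[OF cd] .
  moreover have "q = of_int c / of_int d" using quotient_of_div[OF cd] .
  moreover have "c \<noteq> 0" using calculation assms by auto
  ultimately show ?thesis using that by blast
qed

lemma padic_abs_1 [simp]: "padic_abs p 1 = 1"
  by (simp add: padic_abs_def)

lemma padic_abs_pos: "prime p \<Longrightarrow> q \<noteq> 0 \<Longrightarrow> padic_abs p q > 0"
  by (rule nonzero_rat_cases[of q]) (auto simp: padic_abs_divide prime_gt_0_nat)

lemma padic_abs_nonneg: "prime p \<Longrightarrow> padic_abs p q \<ge> 0"
  using padic_abs_pos[of p q] by (cases "q = 0") auto

lemma padic_abs_mult:
  assumes p: "prime p"
  shows "padic_abs p (x * y) = padic_abs p x * padic_abs p y"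
proof (cases "x = 0 \<or> y = 0")
  case True
  then show ?thesis by auto
next
  case False
  then obtain a b c d where *: "a \<noteq> 0" "b > 0" "x = of_int a / of_int b"
      "c \<noteq> 0" "d > 0" "y = of_int c / of_int d"
    using nonzero_rat_cases by metis
  have xy: "x * y = of_int (a * c) / of_int (b * d)" using * by simp
  have pp: "prime_elem (int p)" using p by simp
  have m: "multiplicity (int p) (a * c) = multiplicity (int p) a + multiplicity (int p) c"
    "multiplicity (int p) (b * d) = multiplicity (int p) b + multiplicity (int p) d"
    using * pp by (auto intro!: prime_elem_multiplicity_mult_distrib)
  have "padic_abs p (x * y) =
      real p powi (int (multiplicity (int p) (b * d)) - int (multiplicity (int p) (a * c)))"
    unfolding xy using * p by (intro padic_abs_divide) auto
  also have "\<dots> = real p powi ((int (multiplicity (int p) b) - int (multiplicity (int p) a)) +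
      (int (multiplicity (int p) d) - int (multiplicity (int p) c)))"
    unfolding m by (rule arg_cong[where f = "\<lambda>k. real p powi k"]) simp
  also have "\<dots> = padic_abs p x * padic_abs p y"
    using * p by (simp add: padic_abs_divide power_int_add prime_gt_0_nat)
  finally show ?thesis .
qed

lemma padic_abs_uminus [simp]: "padic_abs p (- x) = padic_abs p x"
proof -
  have "multiplicity (int p) (- a) = multiplicity (int p) a" for a
    by (simp add: multiplicity_def)
  then show ?thesis
    by (cases "quotient_of x") (auto simp: padic_abs_def rat_uminus_code)
qed

lemma padic_abs_add_le:
  assumes p: "prime p"
  shows "padic_abs p (x + y) \<le> max (padic_abs p x) (padic_abs p y)"
proof (cases "x = 0 \<or> y = 0 \<or> x + y = 0")
  case True
  then show ?thesis using padic_abs_nonneg[OF p, of x] padic_abs_nonneg[OF p, of y] by auto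
next
  case False
  then obtain a b c d where *: "a \<noteq> 0" "b > 0" "x = of_int a / of_int b"
      "c \<noteq> 0" "d > 0" "y = of_int c / of_int d"
    using nonzero_rat_cases by metis
  let ?m = "multiplicity (int p)"
  have pp: "prime_elem (int p)" using p by simp
  have x: "x = of_int (a * d) / of_int (b * d)" and y: "y = of_int (c * b) / of_int (b * d)"
    using * by simp_all
  have xy: "x + y = of_int (a * d + c * b) / of_int (b * d)"
    by (simp only: x y of_int_add add_divide_distrib)
  have nz: "a * d + c * b \<noteq> 0"
  proof
    assume "a * d + c * b = 0"
    then show False using xy False by simp
  qed
  have "min (?m (a * d)) (?m (c * b)) \<le> ?m (a * d + c * b)"
  proof (rule multiplicity_geI[OF nz])
    show "\<not> is_unit (int p)" using pp by (rule prime_elem_not_unit)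
    show "int p ^ min (?m (a * d)) (?m (c * b)) dvd a * d + c * b"
      by (intro dvd_add multiplicity_dvd') simp_all
  qed
  then have "int (?m (b * d)) - int (?m (a * d + c * b)) \<le> int (?m (b * d)) - int (?m (a * d))
      \<or> int (?m (b * d)) - int (?m (a * d + c * b)) \<le> int (?m (b * d)) - int (?m (c * b))"
    by linarith
  then have "real p powi (int (?m (b * d)) - int (?m (a * d + c * b)))
        \<le> real p powi (int (?m (b * d)) - int (?m (a * d)))
      \<or> real p powi (int (?m (b * d)) - int (?m (a * d + c * b)))
        \<le> real p powi (int (?m (b * d)) - int (?m (c * b)))"
    using p by (auto intro: power_int_increasing simp: prime_gt_0_nat Suc_leI)
  moreover have "padic_abs p (x + y) = real p powi (int (?m (b * d)) - int (?m (a * d + c * b)))"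
    unfolding xy using nz * p by (intro padic_abs_divide) auto
  moreover have "padic_abs p x = real p powi (int (?m (b * d)) - int (?m (a * d)))"
    unfolding x using * p by (intro padic_abs_divide) auto
  moreover have "padic_abs p y = real p powi (int (?m (b * d)) - int (?m (c * b)))"
    unfolding y using * p by (intro padic_abs_divide) auto
  ultimately show ?thesis by auto
qed

lemma padic_abs_inverse:
  assumes p: "prime p"
  shows "padic_abs p (inverse x) = inverse (padic_abs p x)"
proof (cases "x = 0")
  case False
  then have "padic_abs p x * padic_abs p (inverse x) = 1"
    by (simp flip: padic_abs_mult[OF p])
  then show ?thesis by (metis inverse_unique)
qed simp

lemma padic_null_iff:
  "prime p \<Longrightarrow> padic_null p X \<longleftrightarrow> (\<lambda>n. padic_abs p (X n)) \<longlonglongrightarrow> 0"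
  by (simp add: padic_null_def LIMSEQ_def padic_abs_nonneg)

lemma padic_null_add:
  assumes p: "prime p" and X: "padic_null p X" and Y: "padic_null p Y"
  shows "padic_null p (\<lambda>n. X n + Y n)"
  unfolding padic_null_def
proof (intro allI impI)
  fix e :: real assume e: "e > 0"
  obtain K where K: "\<And>n. n \<ge> K \<Longrightarrow> padic_abs p (X n) < e"
    using X e unfolding padic_null_def by blast
  obtain L where L: "\<And>n. n \<ge> L \<Longrightarrow> padic_abs p (Y n) < e"
    using Y e unfolding padic_null_def by blast
  have "padic_abs p (X n + Y n) < e" if "n \<ge> max K L" for n
    using padic_abs_add_le[OF p, of "X n" "Y n"] K[of n] L[of n] that by simp
  then show "\<exists>K. \<forall>n\<ge>K. padic_abs p (X n + Y n) < e" by blast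
qed

lemma padic_null_imp_Cauchy:
  assumes p: "prime p" and X: "padic_null p X"
  shows "padic_Cauchy p X"
  unfolding padic_Cauchy_def
proof (intro allI impI)
  fix e :: real assume "e > 0"
  then obtain K where K: "\<And>n. n \<ge> K \<Longrightarrow> padic_abs p (X n) < e"
    using X by (auto simp: padic_null_def)
  have "padic_abs p (X m - X n) < e" if "m \<ge> K" "n \<ge> K" for m n
    using padic_abs_add_le[OF p, of "X m" "- X n"] K[OF that(1)] K[OF that(2)] by simp
  then show "\<exists>K. \<forall>m\<ge>K. \<forall>n\<ge>K. padic_abs p (X m - X n) < e" by blast
qed

lemma padic_Cauchy_const: "padic_Cauchy p (\<lambda>n. c)"
  by (simp add: padic_Cauchy_def)

lemma padic_Cauchy_uminus: "padic_Cauchy p X \<Longrightarrow> padic_Cauchy p (\<lambda>n. - X n)"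
proof -
  have *: "padic_abs p (- X m - - X n) = padic_abs p (X m - X n)" for m n
    using padic_abs_uminus[of p "X m - X n"] by simp
  show "padic_Cauchy p X \<Longrightarrow> padic_Cauchy p (\<lambda>n. - X n)"
    unfolding padic_Cauchy_def * .
qed

lemma padic_Cauchy_add:
  assumes p: "prime p" and X: "padic_Cauchy p X" and Y: "padic_Cauchy p Y"
  shows "padic_Cauchy p (\<lambda>n. X n + Y n)"
  unfolding padic_Cauchy_def
proof (intro allI impI)
  fix e :: real assume e: "e > 0"
  obtain K where K: "\<And>m n. m \<ge> K \<Longrightarrow> n \<ge> K \<Longrightarrow> padic_abs p (X m - X n) < e"
    using X e unfolding padic_Cauchy_def by blast
  obtain L where L: "\<And>m n. m \<ge> L \<Longrightarrow> n \<ge> L \<Longrightarrow> padic_abs p (Y m - Y n) < e"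
    using Y e unfolding padic_Cauchy_def by blast
  have "padic_abs p (X m + Y m - (X n + Y n)) < e" if "m \<ge> max K L" "n \<ge> max K L" for m n
  proof -
    have "padic_abs p (X m + Y m - (X n + Y n)) = padic_abs p ((X m - X n) + (Y m - Y n))"
      by (simp add: algebra_simps)
    also have "\<dots> \<le> max (padic_abs p (X m - X n)) (padic_abs p (Y m - Y n))"
      by (rule padic_abs_add_le[OF p])
    also have "\<dots> < e" using K[of m n] L[of m n] that by simp
    finally show ?thesis .
  qed
  then show "\<exists>K. \<forall>m\<ge>K. \<forall>n\<ge>K. padic_abs p (X m + Y m - (X n + Y n)) < e" by blast
qed

lemma padic_Cauchy_bounded:
  assumes p: "prime p" and X: "padic_Cauchy p X"
  obtains B where "B > 0" and "\<And>n. padic_abs p (X n) \<le> B"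
proof -
  obtain K where K: "\<And>m n. m \<ge> K \<Longrightarrow> n \<ge> K \<Longrightarrow> padic_abs p (X m - X n) < 1"
    using X unfolding padic_Cauchy_def by (meson zero_less_one)
  define B where "B = 1 + (\<Sum>k\<le>K. padic_abs p (X k))"
  have le: "padic_abs p (X k) \<le> B" if "k \<le> K" for k
    using that padic_abs_nonneg[OF p] member_le_sum[of k "{..K}" "\<lambda>k. padic_abs p (X k)"]
    by (auto simp: B_def)
  have B1: "B \<ge> 1" using padic_abs_nonneg[OF p] by (simp add: B_def sum_nonneg)
  have "padic_abs p (X n) \<le> B" for n
  proof (cases "n \<le> K")
    case False
    then have "padic_abs p (X n - X K) \<le> B" using K[of n K] B1 by simp
    then show ?thesis using padic_abs_add_le[OF p, of "X n - X K" "X K"] le[of K] by simp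
  qed (rule le)
  then show ?thesis using that[of B] B1 by simp
qed

lemma padic_Cauchy_mult:
  assumes p: "prime p" and X: "padic_Cauchy p X" and Y: "padic_Cauchy p Y"
  shows "padic_Cauchy p (\<lambda>n. X n * Y n)"
  unfolding padic_Cauchy_def
proof (intro allI impI)
  fix e :: real assume e: "e > 0"
  obtain B where B: "B > 0" "\<And>n. padic_abs p (X n) \<le> B"
    using padic_Cauchy_bounded[OF p X] by metis
  obtain C where C: "C > 0" "\<And>n. padic_abs p (Y n) \<le> C"
    using padic_Cauchy_bounded[OF p Y] by metis
  obtain K where K: "\<And>m n. m \<ge> K \<Longrightarrow> n \<ge> K \<Longrightarrow> padic_abs p (X m - X n) < e / C"
    using X e C unfolding padic_Cauchy_def by (meson divide_pos_pos)
  obtain L where L: "\<And>m n. m \<ge> L \<Longrightarrow> n \<ge> L \<Longrightarrow> padic_abs p (Y m - Y n) < e / B"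
    using Y e B unfolding padic_Cauchy_def by (meson divide_pos_pos)
  have "padic_abs p (X m * Y m - X n * Y n) < e" if "m \<ge> max K L" "n \<ge> max K L" for m n
  proof -
    have "padic_abs p (X m * Y m - X n * Y n)
        = padic_abs p ((X m - X n) * Y m + X n * (Y m - Y n))"
      by (simp add: algebra_simps)
    also have "\<dots> \<le> max (padic_abs p (X m - X n) * padic_abs p (Y m))
        (padic_abs p (X n) * padic_abs p (Y m - Y n))"
      using padic_abs_add_le[OF p] by (simp flip: padic_abs_mult[OF p])
    also have "\<dots> \<le> max (padic_abs p (X m - X n) * C) (B * padic_abs p (Y m - Y n))"
      using B C padic_abs_nonneg[OF p] by (intro max.mono mult_mono) (auto simp: less_imp_le)
    also have "\<dots> < e" using K[of m n] L[of m n] that B C by (simp add: field_simps)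
    finally show ?thesis .
  qed
  then show "\<exists>K. \<forall>m\<ge>K. \<forall>n\<ge>K. padic_abs p (X m * Y m - X n * Y n) < e" by blast
qed

lemma padic_null_mult:
  assumes p: "prime p" and X: "padic_Cauchy p X" and Y: "padic_null p Y"
  shows "padic_null p (\<lambda>n. X n * Y n)"
proof -
  obtain B where B: "B > 0" "\<And>n. padic_abs p (X n) \<le> B"
    using padic_Cauchy_bounded[OF p X] by metis
  have Y0: "(\<lambda>n. padic_abs p (Y n)) \<longlonglongrightarrow> 0"
    using Y by (simp add: padic_null_iff[OF p])
  show ?thesis
    unfolding padic_null_iff[OF p]
  proof (rule tendsto_0_le[OF Y0, where K = B])
    show "\<forall>\<^sub>F n in sequentially. norm (padic_abs p (X n * Y n)) \<le> norm (padic_abs p (Y n)) * B"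
      using B padic_abs_nonneg[OF p]
      by (simp add: padic_abs_mult[OF p] mult.commute[of _ B] mult_right_mono)
  qed
qed

lemma padic_Cauchy_not_null:
  assumes p: "prime p" and X: "padic_Cauchy p X" and N: "\<not> padic_null p X"
  obtains e K where "e > 0" and "\<And>n. n \<ge> K \<Longrightarrow> padic_abs p (X n) \<ge> e"
proof -
  obtain e where e: "e > 0" "\<And>K. \<exists>n\<ge>K. padic_abs p (X n) \<ge> e"
    using N by (auto simp: padic_null_def not_less)
  obtain K where K: "\<And>m n. m \<ge> K \<Longrightarrow> n \<ge> K \<Longrightarrow> padic_abs p (X m - X n) < e"
    using X e(1) unfolding padic_Cauchy_def by blast
  have "padic_abs p (X n) \<ge> e" if n: "n \<ge> K" for n
  proof -
    obtain m where m: "m \<ge> K" "padic_abs p (X m) \<ge> e" using e(2) by blast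
    show ?thesis
      using padic_abs_add_le[OF p, of "X m - X n" "X n"] K[OF m(1) n] m(2) by auto
  qed
  then show ?thesis using that e(1) by blast
qed

lemma padic_Cauchy_inverse:
  assumes p: "prime p" and X: "padic_Cauchy p X" and N: "\<not> padic_null p X"
  shows "padic_Cauchy p (\<lambda>n. inverse (X n))"
  unfolding padic_Cauchy_def
proof (intro allI impI)
  fix e :: real assume e: "e > 0"
  obtain d K where d: "d > 0" and K: "\<And>n. n \<ge> K \<Longrightarrow> padic_abs p (X n) \<ge> d"
    using padic_Cauchy_not_null[OF p X N] by metis
  have ed: "e * (d * d) > 0" using e d by simp
  obtain L where L: "\<And>m n. m \<ge> L \<Longrightarrow> n \<ge> L \<Longrightarrow> padic_abs p (X m - X n) < e * (d * d)"
    using X ed unfolding padic_Cauchy_def by blast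
  have "padic_abs p (inverse (X m) - inverse (X n)) < e"
    if mn: "m \<ge> max K L" "n \<ge> max K L" for m n
  proof -
    have Km: "padic_abs p (X m) \<ge> d" and Kn: "padic_abs p (X n) \<ge> d"
      using K[of m] K[of n] mn by auto
    have nz: "X m \<noteq> 0" "X n \<noteq> 0" using Km Kn d by auto
    have eq: "(inverse (X m) - inverse (X n)) * (X m * X n) = - (X m - X n)"
      using nz by (simp add: field_simps)
    have "padic_abs p (inverse (X m) - inverse (X n)) * (d * d)
        \<le> padic_abs p (inverse (X m) - inverse (X n)) * (padic_abs p (X m) * padic_abs p (X n))"
      using Km Kn d padic_abs_nonneg[OF p] by (intro mult_left_mono mult_mono) auto
    also have "\<dots> = padic_abs p (X m - X n)"
      unfolding padic_abs_mult[OF p, symmetric] eq by (rule padic_abs_uminus)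
    also have "\<dots> < e * (d * d)" using L[of m n] mn by simp
    finally show ?thesis using d by simp
  qed
  then show "\<exists>K. \<forall>m\<ge>K. \<forall>n\<ge>K. padic_abs p (inverse (X m) - inverse (X n)) < e" by blast
qed

lemma padic_Cauchy_ring_cring:
  assumes p: "prime p"
  shows "cring (padic_Cauchy_ring p)"
proof (rule cringI)
  show "abelian_group (padic_Cauchy_ring p)"
  proof (rule abelian_groupI)
    fix X assume X: "X \<in> carrier (padic_Cauchy_ring p)"
    then show "\<exists>Y\<in>carrier (padic_Cauchy_ring p).
        Y \<oplus>\<^bsub>padic_Cauchy_ring p\<^esub> X = \<zero>\<^bsub>padic_Cauchy_ring p\<^esub>"
      by (intro bexI[of _ "\<lambda>n. - X n"])
        (auto simp: padic_Cauchy_ring_def padic_Cauchy_uminus)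
  qed (auto simp: padic_Cauchy_ring_def padic_Cauchy_add[OF p] padic_Cauchy_const algebra_simps)
  show "comm_monoid (padic_Cauchy_ring p)"
    by (rule comm_monoidI)
      (auto simp: padic_Cauchy_ring_def padic_Cauchy_mult[OF p] padic_Cauchy_const algebra_simps)
qed (auto simp: padic_Cauchy_ring_def algebra_simps)

lemma padic_Cauchy_ring_a_inv:
  assumes p: "prime p" and X: "padic_Cauchy p X"
  shows "\<ominus>\<^bsub>padic_Cauchy_ring p\<^esub> X = (\<lambda>n. - X n)"
proof -
  interpret cring "padic_Cauchy_ring p" by (rule padic_Cauchy_ring_cring[OF p])
  show ?thesis
    by (rule minus_equality)
      (use X in \<open>auto simp: padic_Cauchy_ring_def padic_Cauchy_uminus\<close>)
qed

lemma padic_null_ideal: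
  assumes p: "prime p"
  shows "ideal {X. padic_null p X} (padic_Cauchy_ring p)"
proof -
  interpret cring "padic_Cauchy_ring p" by (rule padic_Cauchy_ring_cring[OF p])
  show ?thesis
  proof (rule idealI)
    show "ring (padic_Cauchy_ring p)" by (rule ring_axioms)
    show "subgroup {X. padic_null p X} (add_monoid (padic_Cauchy_ring p))"
    proof (rule add.subgroupI)
      show "{X. padic_null p X} \<subseteq> carrier (padic_Cauchy_ring p)"
        by (auto simp: padic_Cauchy_ring_def padic_null_imp_Cauchy[OF p])
      have "padic_null p (\<lambda>n. 0)" by (simp add: padic_null_def)
      then show "{X. padic_null p X} \<noteq> {}" by blast
    next
      fix X assume "X \<in> {X. padic_null p X}"
      then show "\<ominus>\<^bsub>padic_Cauchy_ring p\<^esub> X \<in> {X. padic_null p X}"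
        by (simp add: padic_Cauchy_ring_a_inv[OF p] padic_null_imp_Cauchy[OF p])
          (simp add: padic_null_def)
    next
      fix X Y assume "X \<in> {X. padic_null p X}" "Y \<in> {X. padic_null p X}"
      then show "X \<oplus>\<^bsub>padic_Cauchy_ring p\<^esub> Y \<in> {X. padic_null p X}"
        by (simp add: padic_Cauchy_ring_def padic_null_add[OF p])
    qed
  next
    fix X Y assume *: "X \<in> {X. padic_null p X}" "Y \<in> carrier (padic_Cauchy_ring p)"
    then show "Y \<otimes>\<^bsub>padic_Cauchy_ring p\<^esub> X \<in> {X. padic_null p X}"
      by (simp add: padic_Cauchy_ring_def padic_null_mult[OF p])
    have "(\<lambda>n. X n * Y n) = (\<lambda>n. Y n * X n)" by (simp add: mult.commute)
    then show "X \<otimes>\<^bsub>padic_Cauchy_ring p\<^esub> Y \<in> {X. padic_null p X}"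
      using * by (simp add: padic_Cauchy_ring_def padic_null_mult[OF p])
  qed
qed

theorem padic_field_field:
  assumes p: "prime p"
  shows "field (padic_field p)"
proof -
  let ?R = "padic_Cauchy_ring p" and ?I = "{X. padic_null p X}"
  interpret R: cring ?R by (rule padic_Cauchy_ring_cring[OF p])
  interpret I: ideal ?I ?R by (rule padic_null_ideal[OF p])
  interpret Q: cring "?R Quot ?I" by (rule I.quotient_is_cring[OF R.is_cring])
  have carr: "carrier (?R Quot ?I) = (\<Union>X\<in>carrier ?R. {?I +>\<^bsub>?R\<^esub> X})"
    by (simp add: FactRing_def A_RCOSETS_def')
  have one: "\<one>\<^bsub>?R\<^esub> = (\<lambda>n. 1)" by (simp add: padic_Cauchy_ring_def)
  have "\<not> padic_null p (\<lambda>n. 1)"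
    unfolding padic_null_def padic_abs_1 by (meson less_irrefl order_refl zero_less_one)
  then have "\<zero>\<^bsub>?R Quot ?I\<^esub> \<noteq> \<one>\<^bsub>?R Quot ?I\<^esub>"
    using I.rcos_const_imp_mem[OF R.one_closed] by (auto simp: FactRing_def one)
  moreover have "\<exists>b\<in>carrier (?R Quot ?I). a \<otimes>\<^bsub>?R Quot ?I\<^esub> b = \<one>\<^bsub>?R Quot ?I\<^esub>"
    if a: "a \<in> carrier (?R Quot ?I)" "a \<noteq> \<zero>\<^bsub>?R Quot ?I\<^esub>" for a
  proof -
    obtain X where X: "X \<in> carrier ?R" and aX: "a = ?I +>\<^bsub>?R\<^esub> X"
      using a(1) by (auto simp: carr)
    have XC: "padic_Cauchy p X" using X by (simp add: padic_Cauchy_ring_def)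
    have XN: "\<not> padic_null p X"
      using a(2) aX I.a_rcos_const[of X] by (auto simp: FactRing_def)
    define Y where "Y = (\<lambda>n. inverse (X n))"
    have Y: "Y \<in> carrier ?R"
      using padic_Cauchy_inverse[OF p XC XN] by (simp add: Y_def padic_Cauchy_ring_def)
    obtain e K where e: "e > 0" and K: "\<And>n. n \<ge> K \<Longrightarrow> padic_abs p (X n) \<ge> e"
      using padic_Cauchy_not_null[OF p XC XN] by metis
    have "X n * Y n + - 1 = 0" if "n \<ge> K" for n
    proof -
      have "X n \<noteq> 0" using K[OF that] e by auto
      then show ?thesis by (simp add: Y_def)
    qed
    then have "padic_null p (\<lambda>n. X n * Y n + - 1)"
      unfolding padic_null_def by (metis padic_abs_0)
    moreover have "X \<otimes>\<^bsub>?R\<^esub> Y \<ominus>\<^bsub>?R\<^esub> \<one>\<^bsub>?R\<^esub> = (\<lambda>n. X n * Y n + - 1)"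
      using padic_Cauchy_ring_a_inv[OF p padic_Cauchy_const[of p 1]]
      unfolding a_minus_def one by (simp add: padic_Cauchy_ring_def)
    ultimately have "?I +>\<^bsub>?R\<^esub> (X \<otimes>\<^bsub>?R\<^esub> Y) = ?I +>\<^bsub>?R\<^esub> \<one>\<^bsub>?R\<^esub>"
      using R.quotient_eq_iff_same_a_r_cos[OF padic_null_ideal[OF p], of "X \<otimes>\<^bsub>?R\<^esub> Y" "\<one>\<^bsub>?R\<^esub>"]
        X Y by auto
    then have "a \<otimes>\<^bsub>?R Quot ?I\<^esub> (?I +>\<^bsub>?R\<^esub> Y) = \<one>\<^bsub>?R Quot ?I\<^esub>"
      using X Y by (simp add: aX FactRing_def I.rcoset_mult_add)
    moreover have "?I +>\<^bsub>?R\<^esub> Y \<in> carrier (?R Quot ?I)"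
      using Y by (auto simp: carr)
    ultimately show ?thesis by blast
  qed
  ultimately show ?thesis
    unfolding padic_field_def by (rule Q.cring_fieldI2)
qed

end

theory Submission
  imports Defs "HOL-Computational_Algebra.Polynomial" "HOL-Number_Theory.Residues"
begin

text \<open>
  Write $\phi = \phi(p^h)$. Three observations give the bound.

  \<^emph>\<open>From p-adic numbers to integers.\<close> The equations are homogeneous, so approximating the solution by
  rationals and rescaling produces integers $b_{il}$, not all divisible by $p$, that satisfy every
  equation modulo $p^{W(h+1)M}$ (\<open>primitive_integral_approximate_solution\<close>).

  \<^emph>\<open>From all levels to one level.\<close> Since $W(h+1) \le \phi$ and $m \ge M$, the power $b^{\phi m}$ of
  a multiple $b$ of $p$ vanishes modulo $p^{W(h+1)M}$. If $l$ is the least level that contains a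
  unit, then every other level is divisible by $p^{(l+1)(h+1)M}$, because the weights
  $p^{l(h+1)M}$ grow by the factor $p^{(h+1)M}$. Hence the units of level $l$ alone satisfy
  $\sum_i b_{il}^{\phi m} \equiv 0$ modulo $p^{(h+1)M}$ for all $m$, and $y_i = b_{il}^\phi$ is
  $1$ modulo $p^h$ by Euler.

  \<^emph>\<open>Counting the units.\<close> The number $t$ of these units is the value of the power sum
  $\sum_i y_i^m$ at $m = 0$, and it is obtained by interpolation from the $r$ exponents at hand. The
  variable of interpolation is not $m$, as the binomial expansion of $(1 + p^h z)^m$ would bring the
  denominators $j!$ into the remainder, but $X = g^m$ with $g = 1 + p^h$. This
  $g$ generates the residues that are $1$ modulo $p^h$, so $y_i \equiv g^{w_i}$ and the power sum is
  $H(g^m)$ for the integral polynomial $H = \sum_i X^{w_i}$, with $H(1) = t$. All nodes are $1$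
  modulo $p^h$, and two of them differ by $g^m - g^{m'}$, of valuation exactly $h + v(m - m')$.
  Lagrange interpolation with integral remainder therefore expresses $H(1)$ through
  $\prod_m (1 - g^m)$, which is divisible by $p^{rh}$, and through the values $H(g^m)$, whose
  divisibility by $p^{(h+1)M}$ outweighs the denominators: the contributions $h$ cancel against the
  factors $1 - g^{m'}$ in the numerators, and $\sum_{m' \ne m} v(m - m') < M$ for exponents in
  $[M, 2M)$, while $r \le M$. So $p^{rh}$ divides $t$, and
  $0 < t \le s$ (\<open>prime_power_dvd_card_if_dvd_power_sums\<close>).
\<close>


section \<open>Valuations of differences of exponents and of powers\<close>

lemma multiplicity_mult_prime_int:
  fixes p :: int
  assumes p: "prime p" and "x \<noteq> 0" and "y \<noteq> 0"
  shows "multiplicity p (x * y) = multiplicity p x + multiplicity p y"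
  using assms by (intro prime_elem_multiplicity_mult_distrib prime_imp_prime_elem)

lemma multiplicity_prime_self_int: "prime (p :: int) \<Longrightarrow> multiplicity p p = 1"
  by (intro multiplicity_prime prime_imp_prime_elem)

lemma multiplicity_diff_commute: "multiplicity p (x - y) = multiplicity p (y - x :: int)"
proof -
  have "x - y = - (y - x)" by simp
  then show ?thesis by (simp only: multiplicity_def dvd_minus_iff)
qed

text \<open>
  This is the weak form $v_p(n!) \le n$ of Legendre's formula. Only the multiples $pj$ contribute,
  and $v(pj) = 1 + v(j)$ reduces $n$ to $\lfloor n/p \rfloor$ at the cost of $\lfloor n/p \rfloor$,
  where $2 \lfloor n/p \rfloor \le n$.
\<close>

lemma sum_multiplicity_upto_le:
  fixes p :: int
  assumes p: "prime p"
  shows "(\<Sum>d\<in>{1..n}. multiplicity p (int d)) \<le> n"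
proof (induction n rule: less_induct)
  case (less n)
  define q where "q = nat p"
  have pq: "p = int q" and q: "q \<ge> 2"
    using prime_ge_2_int[OF p] by (auto simp: q_def)
  show ?case
  proof (cases "n = 0")
    case False
    let ?D = "(\<lambda>j. q * j) ` {1..n div q}"
    have D: "{d \<in> {1..n}. q dvd d} = ?D"
    proof (intro equalityI subsetI)
      fix d assume "d \<in> {d \<in> {1..n}. q dvd d}"
      then obtain j where j: "d = q * j" "1 \<le> d" "d \<le> n" by auto
      then have "1 \<le> j" "j \<le> n div q"
        using q by (auto simp: less_eq_div_iff_mult_less_eq mult.commute Suc_le_eq)
      then show "d \<in> ?D" using j by auto
    next
      fix d assume "d \<in> ?D"
      then show "d \<in> {d \<in> {1..n}. q dvd d}"
        using q by (auto simp: less_eq_div_iff_mult_less_eq mult.commute Suc_le_eq)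
    qed
    have inj: "inj_on (\<lambda>j. q * j) {1..n div q}"
      using q by (auto simp: inj_on_def)
    have "(\<Sum>d\<in>{1..n}. multiplicity p (int d)) = (\<Sum>d\<in>{d \<in> {1..n}. q dvd d}. multiplicity p (int d))"
      by (rule sum.mono_neutral_right) (auto simp: pq not_dvd_imp_multiplicity_0)
    also have "\<dots> = (\<Sum>j\<in>{1..n div q}. multiplicity p (p * int j))"
      unfolding D by (subst sum.reindex[OF inj]) (simp add: pq)
    also have "\<dots> = (\<Sum>j\<in>{1..n div q}. 1 + multiplicity p (int j))"
      using p by (intro sum.cong refl)
        (auto simp: multiplicity_mult_prime_int multiplicity_prime_self_int)
    also have "\<dots> = n div q + (\<Sum>j\<in>{1..n div q}. multiplicity p (int j))"
      by (simp only: sum.distrib) simp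
    also have "\<dots> \<le> n div q + n div q"
      using less.IH[of "n div q"] False q by auto
    also have "\<dots> \<le> n"
    proof -
      have "2 * (n div q) \<le> q * (n div q)" using q by (intro mult_right_mono) auto
      also have "\<dots> \<le> n" by simp
      finally show ?thesis by simp
    qed
    finally show ?thesis .
  qed simp
qed

text \<open>
  The differences to the smaller elements lie in $[1, k - M]$ and those to the larger ones in
  $[1, 2M - 1 - k]$. These two lengths add up to $M - 1$.
\<close>

lemma sum_multiplicity_diff_less:
  fixes p :: int
  assumes p: "prime p" and S: "S \<subseteq> {M..<2 * M}" and k: "k \<in> S"
  shows "(\<Sum>j\<in>S - {k}. multiplicity p (int k - int j)) < M"
proof -
  have fin: "finite S" using S finite_subset by blast
  have k': "M \<le> k" "k < 2 * M" using S k by auto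
  let ?L = "{j \<in> S. j < k}" and ?U = "{j \<in> S. k < j}"
  have "S - {k} = ?L \<union> ?U" by auto
  then have "(\<Sum>j\<in>S - {k}. multiplicity p (int k - int j)) =
      (\<Sum>j\<in>?L. multiplicity p (int k - int j)) + (\<Sum>j\<in>?U. multiplicity p (int k - int j))"
    using fin by (simp add: sum.union_disjoint disjoint_iff)
  also have "(\<Sum>j\<in>?L. multiplicity p (int k - int j))
      = (\<Sum>d\<in>(\<lambda>j. k - j) ` ?L. multiplicity p (int d))"
    by (subst sum.reindex) (auto simp: inj_on_def intro!: sum.cong)
  also have "\<dots> \<le> (\<Sum>d\<in>{1..k - M}. multiplicity p (int d))"
  proof (rule sum_mono2)
    show "(\<lambda>j. k - j) ` ?L \<subseteq> {1..k - M}"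
      using S by (auto simp: Suc_le_eq intro!: diff_le_mono2)
  qed auto
  also have "\<dots> \<le> k - M" by (rule sum_multiplicity_upto_le[OF p])
  also have "(\<Sum>j\<in>?U. multiplicity p (int k - int j))
      = (\<Sum>j\<in>?U. multiplicity p (int (j - k)))"
  proof (intro sum.cong refl)
    fix j assume "j \<in> ?U"
    then show "multiplicity p (int k - int j) = multiplicity p (int (j - k))"
      by (simp add: of_nat_diff multiplicity_diff_commute[of p "int k"])
  qed
  also have "\<dots> = (\<Sum>d\<in>(\<lambda>j. j - k) ` ?U. multiplicity p (int d))"
    by (subst sum.reindex) (auto simp: inj_on_def)
  also have "\<dots> \<le> (\<Sum>d\<in>{1..2 * M - 1 - k}. multiplicity p (int d))"
  proof (rule sum_mono2)
    show "(\<lambda>j. j - k) ` ?U \<subseteq> {1..2 * M - 1 - k}"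
      using S by (force simp: Suc_le_eq)
  qed auto
  also have "\<dots> \<le> 2 * M - 1 - k" by (rule sum_multiplicity_upto_le[OF p])
  finally show ?thesis using k' by linarith
qed

text \<open>
  The terms up to the second order are needed explicitly: for odd $p$ and $k = p$ it is the factor
  $p$ in the quadratic coefficient that keeps this term small.
\<close>

lemma one_plus_power_expand:
  fixes x :: "'a :: comm_ring_1"
  shows "\<exists>t. (1 + x) ^ k = 1 + of_nat k * x + of_nat (k choose 2) * x\<^sup>2 + x ^ 3 * t"
proof (induction k)
  case 0
  show ?case by (auto simp: numeral_2_eq_2 intro: exI[of _ 0])
next
  case (Suc k)
  then obtain t where t: "(1 + x) ^ k = 1 + of_nat k * x + of_nat (k choose 2) * x\<^sup>2 + x ^ 3 * t"
    by blast
  have c: "Suc k choose 2 = k + (k choose 2)" by (simp add: numeral_2_eq_2)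
  have "(1 + x) ^ Suc k = 1 + of_nat (Suc k) * x + of_nat (Suc k choose 2) * x\<^sup>2
      + x ^ 3 * (of_nat (k choose 2) + (1 + x) * t)"
    unfolding power_Suc t c by (simp add: algebra_simps power2_eq_square power3_eq_cube)
  then show ?case by blast
qed

text \<open>
  With $x = a - 1$, one has $a^p - 1 = x (p + {p \choose 2} x + x^2 t)$, and the second factor is
  $p$ modulo $p^2$. For $p = 2$ the binomial coefficient is $1$, so that $4 \mid x$ is required; indeed
  $a = 3$ has $v(a - 1) = 1$ but $v(a^2 - 1) = 3$.
\<close>

lemma multiplicity_power_prime_minus_one:
  fixes p a :: int
  assumes p: "prime p" and n: "multiplicity p (a - 1) \<ge> 1"
    and two: "p = 2 \<Longrightarrow> multiplicity p (a - 1) \<ge> 2"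
  shows "multiplicity p (a ^ nat p - 1) = multiplicity p (a - 1) + 1"
proof -
  define x where "x = a - 1"
  have x0: "x \<noteq> 0" using n by (auto simp: x_def)
  have px: "p dvd x" using n multiplicity_dvd'[of 1 p x] by (simp add: x_def)
  obtain q where q: "p = int q" using prime_ge_0_int[OF p] nonneg_int_cases by blast
  obtain t where "(1 + x) ^ q = 1 + of_nat q * x + of_nat (q choose 2) * x\<^sup>2 + x ^ 3 * t"
    using one_plus_power_expand by blast
  then have eq: "a ^ nat p - 1 = x * (p + (int (q choose 2) * x + x\<^sup>2 * t))"
    by (simp add: x_def q algebra_simps power2_eq_square power3_eq_cube)
  have "p\<^sup>2 dvd int (q choose 2) * x"
  proof (cases "p = 2")
    case True
    then have "p\<^sup>2 dvd x" using two multiplicity_dvd'[of 2 p x] by (simp add: x_def)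
    then show ?thesis by simp
  next
    case False
    have "prime q" using p q by simp
    then have "q dvd q choose 2"
      using False q prime_ge_2_nat[of q] by (intro dvd_choose_prime) auto
    then have "p dvd int (q choose 2)" by (simp add: q)
    then show ?thesis using px unfolding power2_eq_square by (rule mult_dvd_mono)
  qed
  moreover have "p\<^sup>2 dvd x\<^sup>2 * t" using px by (simp add: dvd_power_same)
  ultimately obtain z where z: "int (q choose 2) * x + x\<^sup>2 * t = p\<^sup>2 * z"
    by (meson dvd_add dvdE)
  have eq': "a ^ nat p - 1 = p * (x * (1 + p * z))"
    unfolding eq z by (simp add: algebra_simps power2_eq_square)
  have nd: "\<not> p dvd 1 + p * z"
    using p by (metis dvd_add_left_iff dvd_triv_left not_prime_unit)
  then have nz: "1 + p * z \<noteq> 0" by auto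
  show ?thesis
    unfolding eq' using p x0 nd nz
    by (simp add: multiplicity_mult_prime_int multiplicity_prime_self_int
        not_dvd_imp_multiplicity_0 x_def)
qed

text \<open>
  Lifting the exponent: factors $p$ of $d$ are split off one at a time, and an exponent $d$ prime to
  $p$ does not change the valuation because $1 + a + \dots + a^{d-1} \equiv d$ modulo $p$.
\<close>

lemma multiplicity_power_minus_one:
  fixes p a :: int
  assumes p: "prime p" and n: "multiplicity p (a - 1) \<ge> 1"
    and two: "p = 2 \<Longrightarrow> multiplicity p (a - 1) \<ge> 2" and d: "d > 0"
  shows "multiplicity p (a ^ d - 1) = multiplicity p (a - 1) + multiplicity p (int d)"
  using d
proof (induction d rule: less_induct)
  case (less d)
  show ?case
  proof (cases "p dvd int d")
    case True
    have p0: "p > 0" using prime_gt_0_int[OF p] .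
    have "nat p dvd d" using True p0 by (simp add: nat_dvd_iff)
    then obtain e where e: "d = nat p * e" by auto
    have e0: "e > 0" "e < d"
      using less.prems e prime_gt_1_int[OF p] by (auto intro: Nat.gr0I)
    have IH: "multiplicity p (a ^ e - 1) = multiplicity p (a - 1) + multiplicity p (int e)"
      using less.IH e0 by blast
    have "a ^ d - 1 = (a ^ e) ^ nat p - 1" by (simp add: e mult.commute flip: power_mult)
    also have "multiplicity p \<dots> = multiplicity p (a ^ e - 1) + 1"
      using p IH n two by (intro multiplicity_power_prime_minus_one) auto
    also have "\<dots> = multiplicity p (a - 1) + multiplicity p (p * int e)"
      using IH p e0 by (simp add: multiplicity_mult_prime_int multiplicity_prime_self_int)
    finally show ?thesis using p0 by (simp add: e)
  next
    case False
    have pa: "[a = 1] (mod p)"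
      using n multiplicity_dvd'[of 1 p "a - 1"] by (simp add: cong_iff_dvd_diff)
    have "[(\<Sum>i<d. a ^ i) = (\<Sum>i<d. 1 ^ i)] (mod p)"
      by (intro cong_sum cong_pow pa)
    then have nd: "\<not> p dvd (\<Sum>i<d. a ^ i)" using False by (simp add: cong_dvd_iff)
    have "a ^ d - 1 = (a - 1) * (\<Sum>i<d. a ^ i)" by (rule power_diff_1_eq)
    moreover have "a - 1 \<noteq> 0" using n by (auto simp del: right_minus_eq)
    moreover have "(\<Sum>i<d. a ^ i) \<noteq> 0" using nd by auto
    ultimately show ?thesis
      using p nd False by (simp add: multiplicity_mult_prime_int not_dvd_imp_multiplicity_0)
  qed
qed

lemma multiplicity_power_diff:
  fixes p a :: int
  assumes p: "prime p" and n: "multiplicity p (a - 1) \<ge> 1"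
    and two: "p = 2 \<Longrightarrow> multiplicity p (a - 1) \<ge> 2" and ij: "i \<noteq> j"
  shows "multiplicity p (a ^ i - a ^ j) = multiplicity p (a - 1) + multiplicity p (int i - int j)"
proof -
  have "p dvd a - 1" using n multiplicity_dvd'[of 1 p "a - 1"] by simp
  then have pa: "\<not> p dvd a" using p by (metis dvd_diff_right_iff not_prime_unit)
  have *: "multiplicity p (a ^ i - a ^ j) = multiplicity p (a - 1) + multiplicity p (int i - int j)"
    if "j < i" for i j
  proof -
    have eq: "a ^ i - a ^ j = a ^ j * (a ^ (i - j) - 1)"
      using that by (simp add: algebra_simps flip: power_add)
    have m: "multiplicity p (a ^ (i - j) - 1) = multiplicity p (a - 1) + multiplicity p (int i - int j)"
      using multiplicity_power_minus_one[OF p n two, of "i - j"] that by (simp add: of_nat_diff)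
    have "\<not> p dvd a ^ j" using pa p prime_dvd_power by blast
    moreover have "a ^ (i - j) - 1 \<noteq> 0" using m n by (auto simp del: right_minus_eq)
    moreover have "a ^ j \<noteq> 0" using pa by auto
    ultimately show ?thesis
      unfolding eq m[symmetric] using p
      by (simp add: multiplicity_mult_prime_int not_dvd_imp_multiplicity_0)
  qed
  show ?thesis
    using *[of j i] *[of i j] ij multiplicity_diff_commute[of p "a ^ i"]
      multiplicity_diff_commute[of p "int i"] by (cases i j rule: linorder_cases) auto
qed

text \<open>
  The $p$-adic digits of $w$ are found successively. For $N \ge h$ the power
  $g^{p^{N-h}}$ of $g = 1 + p^h$ is $1 + p^N e$ with $p \nmid e$, so that increasing the
  exponent by a multiple $f p^{N-h}$ changes the power by $p^N f e g^w$ modulo $p^{N+1}$, and a suitable $f$ corrects the error at level $N$.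
\<close>

lemma one_plus_prime_power_generates:
  fixes p y :: int
  assumes p: "prime p" and h: "h \<ge> 1" and two: "p = 2 \<Longrightarrow> h \<ge> 2"
    and y: "[y = 1] (mod p ^ h)"
  shows "\<exists>w. [y = (1 + p ^ h) ^ w] (mod p ^ N)"
proof (induction N)
  case 0
  show ?case by simp
next
  case (Suc N)
  define g where "g = 1 + p ^ h"
  show ?case
  proof (cases "Suc N \<le> h")
    case True
    then have "[y = 1] (mod p ^ Suc N)" using y by (meson cong_dvd_modulus le_imp_power_dvd)
    then show ?thesis by (intro exI[of _ 0]) simp
  next
    case False
    then have hN: "h \<le> N" by simp
    obtain w where w: "[y = g ^ w] (mod p ^ N)" using Suc g_def by blast
    then obtain c where c: "y = g ^ w + p ^ N * c"
      by (metis cong_iff_lin cong_sym)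
    have mg: "multiplicity p (g - 1) = h"
      using multiplicity_prime_power[OF prime_imp_prime_elem[OF p]] by (simp add: g_def)
    define u where "u = nat p ^ (N - h)"
    have u: "u > 0" "int u = p ^ (N - h)"
      using prime_gt_0_int[OF p] by (auto simp: u_def)
    have mu: "multiplicity p (g ^ u - 1) = N"
      using multiplicity_power_minus_one[OF p, of g u] mg h two u hN
        multiplicity_prime_power[OF prime_imp_prime_elem[OF p]] by auto
    have gu0: "g ^ u - 1 \<noteq> 0" using mu hN h by (auto simp del: right_minus_eq)
    obtain e where e: "g ^ u - 1 = p ^ N * e" "\<not> p dvd e"
      using multiplicity_decompose'[OF gu0, of p] mu p by (metis not_prime_unit)
    have pg: "\<not> p dvd g" using p h
      by (metis One_nat_def Suc_le_lessD add.commute dvd_add_right_iff dvd_power g_def not_prime_unit)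
    have "\<not> p dvd g ^ w * e" using p pg e(2) by (metis prime_dvd_mult_iff prime_dvd_power)
    then have "coprime (g ^ w * e) p" using p by (metis coprime_commute prime_imp_coprime)
    then obtain b where b: "[g ^ w * e * b = 1] (mod p)" using cong_solve_coprime_int by blast
    \<comment> \<open>The correction solves \<open>g ^ w * e * f = c\<close> modulo \<open>p\<close>; \<open>b\<close> inverts the coefficient.\<close>
    define f where "f = nat (b * c mod p)"
    have f: "int f = b * c mod p" using prime_gt_0_int[OF p] by (simp add: f_def)
    have "[g ^ w * e * int f = g ^ w * e * (b * c)] (mod p)"
      unfolding f by (intro cong_mult cong_refl) (simp add: cong_def)
    also have "[g ^ w * e * (b * c) = 1 * c] (mod p)"
      using cong_mult[OF b cong_refl[of c]] by (simp add: mult.assoc)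
    finally have fc: "[g ^ w * e * int f = c] (mod p)" by simp
    obtain t where t: "(1 + p ^ N * e) ^ f =
        1 + of_nat f * (p ^ N * e) + of_nat (f choose 2) * (p ^ N * e)\<^sup>2 + (p ^ N * e) ^ 3 * t"
      using one_plus_power_expand by blast
    define r where "r = (of_nat (f choose 2) * e\<^sup>2 + p ^ N * e ^ 3 * t)"
    have t': "(1 + p ^ N * e) ^ f = 1 + p ^ N * (e * int f) + p ^ N * p ^ N * r"
      unfolding t r_def by (simp add: algebra_simps power2_eq_square power3_eq_cube)
    have gu: "1 + p ^ N * e = g ^ u" using e(1) by simp
    have "g ^ (w + u * f) = g ^ w * (1 + p ^ N * e) ^ f"
      unfolding gu by (simp add: power_add power_mult)
    also have "\<dots> = g ^ w + p ^ N * (g ^ w * e * int f + p ^ N * (g ^ w * r))"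
      unfolding t' by (simp add: algebra_simps)
    finally have gw: "g ^ (w + u * f) = g ^ w + p ^ N * (g ^ w * e * int f + p ^ N * (g ^ w * r))" .
    have "p dvd p ^ N" using hN h by (intro dvd_power) auto
    then have "[g ^ w * e * int f + p ^ N * (g ^ w * r) = c + 0] (mod p)"
      by (intro cong_add fc) (simp add: cong_0_iff)
    then have "p dvd c - (g ^ w * e * int f + p ^ N * (g ^ w * r))"
      by (simp add: cong_iff_dvd_diff dvd_diff_commute)
    then have "p ^ N * p dvd p ^ N * (c - (g ^ w * e * int f + p ^ N * (g ^ w * r)))"
      by (rule mult_dvd_mono[OF dvd_refl])
    moreover have "p ^ N * (c - (g ^ w * e * int f + p ^ N * (g ^ w * r))) = y - g ^ (w + u * f)"
      unfolding c gw by (simp add: algebra_simps)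
    ultimately have "[y = g ^ (w + u * f)] (mod p ^ Suc N)"
      by (simp only: cong_iff_dvd_diff power_Suc2)
    then show ?thesis unfolding g_def by blast
  qed
qed

section \<open>Lagrange interpolation with an integral remainder\<close>

lemma prod_linear_dvd_if_roots:
  fixes P :: "'a :: idom poly"
  assumes "finite J" and "inj_on X J" and "\<And>k. k \<in> J \<Longrightarrow> poly P (X k) = 0"
  shows "(\<Prod>k\<in>J. [:- X k, 1:]) dvd P"
  using assms
proof (induction J arbitrary: P rule: finite_induct)
  case (insert k J)
  obtain Q where Q: "P = [:- X k, 1:] * Q"
    using insert.prems(2)[of k] by (auto simp: poly_eq_0_iff_dvd)
  have "poly Q (X j) = 0" if "j \<in> J" for j
  proof -
    have "X j \<noteq> X k" using insert.prems(1) insert.hyps that by (metis inj_onD insertCI)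
    then show ?thesis using insert.prems(2)[of j] that unfolding Q by simp
  qed
  then have "(\<Prod>k\<in>J. [:- X k, 1:]) dvd Q"
    using insert.IH insert.prems(1) by simp
  then show ?case unfolding Q prod.insert[OF insert.hyps] by (rule mult_dvd_mono[OF dvd_refl])
qed simp

text \<open>
  If the value of $H$ at each node $X_k$ is a multiple of $A$ times the Lagrange denominator
  $\prod_{j \ne k} (X_k - X_j)$, then the interpolation polynomial of $H$ has coefficients in the ring,
  and $H$ differs from it by a multiple of $\prod_j (X - X_j)$ over the ring itself. The factor $A$
  survives as a factor of the interpolation polynomial, so a surplus of divisibility is passed on to $z$.
\<close>

lemma lagrange_interpolation_dvd:
  fixes H :: "'a :: idom poly"
  assumes J: "finite J" and inj: "inj_on X J"
    and c: "\<And>k. k \<in> J \<Longrightarrow> poly H (X k) = A * c k * (\<Prod>j\<in>J - {k}. X k - X j)"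
  shows "\<exists>b. poly H z = A * (\<Sum>k\<in>J. c k * (\<Prod>j\<in>J - {k}. z - X j)) + (\<Prod>j\<in>J. z - X j) * b"
proof -
  define R where "R = Polynomial.smult A (\<Sum>k\<in>J. Polynomial.smult (c k) (\<Prod>j\<in>J - {k}. [:- X j, 1:]))"
  have R: "poly R x = A * (\<Sum>k\<in>J. c k * (\<Prod>j\<in>J - {k}. x - X j))" for x
    by (simp add: R_def poly_sum poly_prod)
  have "poly (H - R) (X i) = 0" if i: "i \<in> J" for i
  proof -
    \<comment> \<open>Each summand with \<open>k \<noteq> i\<close> has the vanishing factor \<open>X i - X i\<close>.\<close>
    have "(\<Sum>k\<in>J. c k * (\<Prod>j\<in>J - {k}. X i - X j)) =
        (\<Sum>k\<in>J. if k = i then c k * (\<Prod>j\<in>J - {k}. X i - X j) else 0)"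
      using J i by (intro sum.cong refl) auto
    then show ?thesis using c[OF i] J i by (simp add: R)
  qed
  then have "(\<Prod>k\<in>J. [:- X k, 1:]) dvd H - R"
    by (intro prod_linear_dvd_if_roots J inj) auto
  then obtain Q where "H - R = (\<Prod>k\<in>J. [:- X k, 1:]) * Q" by blast
  then have "H = R + (\<Prod>k\<in>J. [:- X k, 1:]) * Q" by (simp add: algebra_simps)
  then have "poly H z = poly R z + (\<Prod>k\<in>J. z - X k) * poly Q z"
    by (simp add: poly_prod)
  then show ?thesis unfolding R by blast
qed

section \<open>Power sums divisible by a high power of p\<close>

text \<open>
  The polynomial $H = \sum_i X^{w_i}$, where $y_i \equiv (1 + p^h)^{w_i}$, is interpolated at the nodes
  $(1 + p^h)^m$ and evaluated at $1$. There every factor $1 - X_j$ is divisible by $p^h$: the remainder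
  term has $|S|$ such factors, and each Lagrange term has $|S| - 1$ of them together with the factor
  $p^h$ split off from the values of $H$.
\<close>

lemma prime_power_dvd_card_if_dvd_power_sums:
  fixes p :: int and y :: "'a \<Rightarrow> int"
  assumes p: "prime p" and h: "h \<ge> 1" and two: "p = 2 \<Longrightarrow> h \<ge> 2"
    and I: "finite I" and y: "\<And>i. i \<in> I \<Longrightarrow> [y i = 1] (mod p ^ h)"
    and S: "S \<subseteq> {M..<2 * M}"
    and dvd: "\<And>m. m \<in> S \<Longrightarrow> p ^ ((h + 1) * M) dvd (\<Sum>i\<in>I. y i ^ m)"
  shows "p ^ (card S * h) dvd int (card I)"
proof (cases "S = {}")
  case False
  define g where "g = 1 + p ^ h"
  define N where "N = (h + 1) * M"
  define X where "X m = g ^ m" for m :: nat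
  have p0: "p > 0" using prime_gt_0_int[OF p] .
  have finS: "finite S" using S finite_subset by blast
  have rM: "card S \<le> M" using card_mono[OF _ S] by simp
  have r0: "card S \<noteq> 0" using False finS by simp
  have g1: "g > 1" using p0 by (simp add: g_def)
  have injX: "inj_on X S" using g1 by (auto simp: inj_on_def X_def power_inject_exp)
  have mg: "multiplicity p (g - 1) = h"
    using multiplicity_prime_power[OF prime_imp_prime_elem[OF p]] by (simp add: g_def)
  obtain w where w: "\<And>i. i \<in> I \<Longrightarrow> [y i = g ^ w i] (mod p ^ N)"
  proof -
    have "\<exists>w. [y i = g ^ w] (mod p ^ N)" if "i \<in> I" for i
      unfolding g_def by (rule one_plus_prime_power_generates[OF p h]) (use two y that in auto)
    then show ?thesis using that by metis
  qed
  define H where "H = (\<Sum>i\<in>I. Polynomial.monom (1 :: int) (w i))"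
  have H: "poly H x = (\<Sum>i\<in>I. x ^ w i)" for x
    by (simp add: H_def poly_sum poly_monom)
  have HX: "p ^ N dvd poly H (X m)" if m: "m \<in> S" for m
  proof -
    have "[(\<Sum>i\<in>I. y i ^ m) = (\<Sum>i\<in>I. (g ^ w i) ^ m)] (mod p ^ N)"
      by (intro cong_sum cong_pow w)
    also have "(\<Sum>i\<in>I. (g ^ w i) ^ m) = poly H (X m)"
      unfolding H X_def by (simp add: mult.commute flip: power_mult)
    finally show ?thesis using dvd[OF m] by (simp add: N_def cong_dvd_iff cong_dvd_modulus)
  qed
  define D where "D k = (\<Prod>j\<in>S - {k}. X k - X j)" for k
  have D0: "D k \<noteq> 0" if "k \<in> S" for k
    using that injX finS by (auto simp: D_def inj_on_def)
  \<comment> \<open>The left side is below \<open>h + (card S - 1) * h + M\<close>, and \<open>card S \<le> M\<close> because \<open>S\<close> lies in \<open>{M..<2 * M}\<close>.\<close>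
  have mD: "h + multiplicity p (D k) < N" if k: "k \<in> S" for k
  proof -
    have "multiplicity p (D k) = (\<Sum>j\<in>S - {k}. multiplicity p (X k - X j))"
      unfolding D_def using k injX finS prime_imp_prime_elem[OF p]
      by (intro prime_elem_multiplicity_prod_distrib) (auto simp: inj_on_def)
    also have "\<dots> = (\<Sum>j\<in>S - {k}. h + multiplicity p (int k - int j))"
    proof (intro sum.cong refl)
      fix j assume j: "j \<in> S - {k}"
      then have "multiplicity p (g ^ k - g ^ j)
          = multiplicity p (g - 1) + multiplicity p (int k - int j)"
        by (intro multiplicity_power_diff[OF p]) (use mg h two in auto)
      then show "multiplicity p (X k - X j) = h + multiplicity p (int k - int j)"
        by (simp add: mg X_def)
    qed
    also have "\<dots> = (card S - 1) * h + (\<Sum>j\<in>S - {k}. multiplicity p (int k - int j))"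
      using k finS by (simp add: sum.distrib)
    finally have "h + multiplicity p (D k) < h + ((card S - 1) * h + M)"
      using sum_multiplicity_diff_less[OF p S k] by simp
    also have "h + ((card S - 1) * h + M) = card S * h + M"
      using r0 by (cases "card S") auto
    also have "\<dots> \<le> M * h + M" using rM by simp
    finally show ?thesis by (simp add: N_def algebra_simps)
  qed
  have "\<exists>e. D k = p ^ multiplicity p (D k) * e \<and> \<not> p dvd e" if "k \<in> S" for k
    using multiplicity_decompose'[OF D0[OF that], of p] p by (metis not_prime_unit)
  then obtain e where e: "\<And>k. k \<in> S \<Longrightarrow> D k = p ^ multiplicity p (D k) * e k"
    and ne: "\<And>k. k \<in> S \<Longrightarrow> \<not> p dvd e k" by metis
  \<comment> \<open>Multiplying by \<open>U\<close>, a unit at \<open>p\<close>, removes the parts of the denominators that are prime to \<open>p\<close>.\<close>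
  define U where "U = (\<Prod>k\<in>S. e k)"
  have "\<not> p dvd U"
    using ne finS p by (auto simp: U_def prime_dvd_prod_iff)
  have "\<exists>c. poly (Polynomial.smult U H) (X k) = p ^ h * c * D k" if k: "k \<in> S" for k
  proof -
    have "e k dvd U" using k finS by (auto simp: U_def)
    moreover have "p ^ (h + multiplicity p (D k)) dvd poly H (X k)"
      using mD[OF k] HX[OF k] by (meson power_le_dvd less_imp_le)
    ultimately have "e k * p ^ (h + multiplicity p (D k)) dvd U * poly H (X k)"
      by (rule mult_dvd_mono)
    moreover have "e k * p ^ (h + multiplicity p (D k)) = p ^ h * D k"
      by (subst (2) e[OF k]) (simp add: power_add algebra_simps)
    ultimately obtain c where "U * poly H (X k) = p ^ h * D k * c" by auto
    then show ?thesis by (intro exI[of _ c]) (simp add: algebra_simps)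
  qed
  then obtain c where c: "\<And>k. k \<in> S \<Longrightarrow> poly (Polynomial.smult U H) (X k) = p ^ h * c k * D k"
    by metis
  obtain b where b: "poly (Polynomial.smult U H) 1
      = p ^ h * (\<Sum>k\<in>S. c k * (\<Prod>j\<in>S - {k}. 1 - X j)) + (\<Prod>j\<in>S. 1 - X j) * b"
    using lagrange_interpolation_dvd[OF finS injX, of "Polynomial.smult U H" "p ^ h" c 1] c
    unfolding D_def by blast
  have X1: "p ^ h dvd 1 - X j" for j
  proof -
    have "[g ^ j = 1 ^ j] (mod p ^ h)"
      by (intro cong_pow) (simp add: g_def cong_iff_dvd_diff)
    then show ?thesis by (simp add: X_def cong_iff_dvd_diff dvd_diff_commute)
  qed
  have prod_dvd: "p ^ (h * card T) dvd (\<Prod>j\<in>T. 1 - X j)" if "finite T" for T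
    using prod_dvd_prod[of T "\<lambda>_. p ^ h" "\<lambda>j. 1 - X j"] X1 by (simp add: power_mult)
  have "p ^ (card S * h) dvd p ^ h * (\<Sum>k\<in>S. c k * (\<Prod>j\<in>S - {k}. 1 - X j))"
  proof -
    have "p ^ (h * (card S - 1)) dvd (\<Sum>k\<in>S. c k * (\<Prod>j\<in>S - {k}. 1 - X j))"
    proof (intro dvd_sum dvd_mult)
      fix k assume "k \<in> S"
      then show "p ^ (h * (card S - 1)) dvd (\<Prod>j\<in>S - {k}. 1 - X j)"
        using prod_dvd[of "S - {k}"] finS by simp
    qed
    moreover have "card S * h = h + h * (card S - 1)"
      using r0 by (cases "card S") auto
    ultimately show ?thesis by (simp add: power_add)
  qed
  moreover have "p ^ (card S * h) dvd (\<Prod>j\<in>S. 1 - X j) * b"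
    using prod_dvd[OF finS] by (simp add: mult.commute)
  ultimately have "p ^ (card S * h) dvd U * int (card I)"
    using b by (simp add: H)
  moreover have "coprime (p ^ (card S * h)) U"
    using \<open>\<not> p dvd U\<close> p by (simp add: prime_imp_coprime)
  ultimately show ?thesis by (simp add: coprime_dvd_mult_right_iff)
qed simp

section \<open>Primitive integral solutions\<close>

lemma euler_theorem_prime_power_int:
  fixes b :: int
  assumes p: "prime p" and h: "h \<ge> 1" and b: "\<not> int p dvd b"
  shows "[b ^ totient (p ^ h) = 1] (mod int p ^ h)"
proof -
  have gt: "1 < int (p ^ h)" using prime_gt_1_nat[OF p] h by (simp add: one_less_power)
  interpret residues "int (p ^ h)" "residue_ring (int (p ^ h))"
    using gt by unfold_locales auto
  have "coprime b (int p)"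
    using b p by (metis coprime_commute prime_imp_coprime prime_nat_int_transfer)
  then have "coprime b (int (p ^ h))" by simp
  from euler_theorem[OF this] show ?thesis by (simp add: nat_power_eq)
qed

text \<open>
  Everything is compared modulo $p^{(l+1)K}$, where $K = (h+1)M$ and $l$ is the least level that
  contains a unit. The lower levels vanish because their entries are raised to a power of at least
  $WK$, the higher ones because of their weights. The exponent $K$ that is left after division by the
  weight $p^{lK}$ is the one required for counting the units of level $l$.
\<close>

lemma le_number_of_variables_if_primitive_solution:
  fixes b :: "nat \<Rightarrow> nat \<Rightarrow> int"
  assumes p: "prime p" and h: "h \<ge> 1" and two: "p = 2 \<Longrightarrow> h \<ge> 2"
    and S: "S \<subseteq> {M..<2 * M}" and W: "W * (h + 1) \<le> totient (p ^ h)"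
    and prim: "i0 \<in> {1..s}" "l0 < W" "\<not> int p dvd b i0 l0"
    and dvd: "\<And>m. m \<in> S \<Longrightarrow> int p ^ (W * (h + 1) * M) dvd
      (\<Sum>l<W. int p ^ (l * (h + 1) * M) * (\<Sum>i\<in>{1..s}. b i l ^ (totient (p ^ h) * m)))"
  shows "p ^ (card S * h) \<le> s"
proof -
  define P where "P k \<longleftrightarrow> k < W \<and> (\<exists>i\<in>{1..s}. \<not> int p dvd b i k)" for k
  have "P l0" using prim by (auto simp: P_def)
  then obtain l where "P l" and min: "\<And>k. k < l \<Longrightarrow> \<not> P k"
    using exists_least_iff[of P] by blast
  then have l: "l < W" "\<exists>i\<in>{1..s}. \<not> int p dvd b i l" by (auto simp: P_def)
  have less_l: "int p dvd b i k" if "k < l" "i \<in> {1..s}" for i k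
    using min[OF that(1)] that l(1) unfolding P_def by auto
  define I where "I = {i \<in> {1..s}. \<not> int p dvd b i l}"
  define n where "n = totient (p ^ h)"
  define K where "K = (h + 1) * M"
  define s' where "s' k m = (\<Sum>i\<in>{1..s}. b i k ^ (n * m))" for k m
  have nonunit: "int p ^ (W * K) dvd a ^ (n * m)" if "int p dvd a" "m \<in> S" for a m
  proof -
    have "W * K \<le> n * M" using mult_le_mono1[OF W, of M] by (simp only: K_def n_def mult.assoc)
    also have "n * M \<le> n * m" using S that by auto
    finally have "int p ^ (W * K) dvd int p ^ (n * m)" by (rule le_imp_power_dvd)
    also have "\<dots> dvd a ^ (n * m)" using that by (simp add: dvd_power_same)
    finally show ?thesis .
  qed
  have level: "int p ^ K dvd s' l m" if m: "m \<in> S" for m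
  proof -
    have lW: "int p ^ (Suc l * K) dvd int p ^ (W * K)"
      using l(1) by (intro le_imp_power_dvd mult_right_mono) auto
    have other: "int p ^ (Suc l * K) dvd int p ^ (k * K) * s' k m" if k: "k < W" "k \<noteq> l" for k
    proof (cases "k < l")
      case True
      have "int p ^ (W * K) dvd s' k m"
        unfolding s'_def using less_l[OF True] by (intro dvd_sum nonunit m) auto
      with lW show ?thesis by (meson dvd_mult dvd_trans)
    next
      case False
      then have "int p ^ (Suc l * K) dvd int p ^ (k * K)"
        using k by (intro le_imp_power_dvd mult_right_mono) auto
      then show ?thesis by (rule dvd_mult2)
    qed
    have "int p ^ (W * K) dvd (\<Sum>k<W. int p ^ (k * K) * s' k m)"
      using dvd[OF m] by (simp only: s'_def n_def K_def mult.assoc)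
    with lW have "int p ^ (Suc l * K) dvd (\<Sum>k<W. int p ^ (k * K) * s' k m)"
      by (rule dvd_trans)
    also have "(\<Sum>k<W. int p ^ (k * K) * s' k m)
        = int p ^ (l * K) * s' l m + (\<Sum>k\<in>{..<W} - {l}. int p ^ (k * K) * s' k m)"
      using l(1) by (simp add: sum.remove)
    finally have "int p ^ (Suc l * K) dvd int p ^ (l * K) * s' l m"
      using other by (subst (asm) dvd_add_left_iff) (auto intro!: dvd_sum)
    then have "int p ^ (l * K) * int p ^ K dvd int p ^ (l * K) * s' l m"
      by (simp add: power_add mult.commute)
    then show ?thesis using p by (simp add: prime_gt_0_nat)
  qed
  have "int p ^ (card S * h) dvd int (card I)"
  proof (rule prime_power_dvd_card_if_dvd_power_sums[where y = "\<lambda>i. b i l ^ n" and M = M])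
    fix m assume m: "m \<in> S"
    have "int p ^ K dvd int p ^ (W * K)" using l(1) by (intro le_imp_power_dvd) simp
    then have "int p ^ K dvd (\<Sum>i\<in>{1..s} - I. b i l ^ (n * m))"
      by (intro dvd_sum) (auto simp: I_def intro: dvd_trans[OF _ nonunit] m)
    moreover have "s' l m = (\<Sum>i\<in>{1..s} - I. b i l ^ (n * m)) + (\<Sum>i\<in>I. b i l ^ (n * m))"
      unfolding s'_def by (rule sum.subset_diff) (auto simp: I_def)
    ultimately show "int p ^ ((h + 1) * M) dvd (\<Sum>i\<in>I. (b i l ^ n) ^ m)"
      using level[OF m] by (simp add: K_def dvd_add_right_iff flip: power_mult)
  qed (use p h two S euler_theorem_prime_power_int[OF p h] in \<open>auto simp: I_def n_def\<close>)
  moreover have "card I > 0" using l(2) by (auto simp: I_def card_gt_0_iff)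
  ultimately have "int p ^ (card S * h) \<le> int (card I)"
    by (intro zdvd_imp_le) auto
  then have "p ^ (card S * h) \<le> card I"
    by (metis of_nat_le_iff of_nat_power)
  also have "card I \<le> card {1..s}" by (intro card_mono) (auto simp: I_def)
  finally show ?thesis by simp
qed

section \<open>From rationals to primitive integers\<close>

lemma padic_abs_of_int:
  assumes "prime p" and "a \<noteq> 0"
  shows "padic_abs p (of_int a) = real p powi (- int (multiplicity (int p) a))"
  using padic_abs_divide[OF assms(1), of a 1] assms(2) by simp

lemma prime_power_dvd_iff_padic_abs_le:
  assumes p: "prime p"
  shows "int p ^ n dvd a \<longleftrightarrow> padic_abs p (of_int a) \<le> real p powi (- int n)"
proof (cases "a = 0")
  case False
  have "\<not> is_unit (int p)" using prime_gt_1_nat[OF p] by simp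
  then have "int p ^ n dvd a \<longleftrightarrow> n \<le> multiplicity (int p) a"
    using False by (intro power_dvd_iff_le_multiplicity)
  also have "\<dots> \<longleftrightarrow> real p powi (- int (multiplicity (int p) a)) \<le> real p powi (- int n)"
    using power_int_increasing[of "- int (multiplicity (int p) a)" "- int n" "real p"]
      power_int_strict_increasing[of "- int n" "- int (multiplicity (int p) a)" "real p"]
      prime_gt_1_nat[OF p] by fastforce
  finally show ?thesis using False by (simp add: padic_abs_of_int[OF p])
qed simp

lemma padic_abs_power: "prime p \<Longrightarrow> padic_abs p (x ^ n) = padic_abs p x ^ n"
  by (induction n) (simp_all add: padic_abs_mult)

lemma denominator_coprime_if_padic_abs_le_1:
  assumes p: "prime p" and q: "padic_abs p q \<le> 1"
  shows "\<not> int p dvd snd (quotient_of q)"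
proof
  assume dvd: "int p dvd snd (quotient_of q)"
  obtain a b where ab: "quotient_of q = (a, b)" by fastforce
  have b: "b > 0" using quotient_of_denom_pos[OF ab] .
  have "coprime a b" using quotient_of_coprime[OF ab] .
  then have na: "\<not> int p dvd a"
    using dvd ab prime_gt_1_nat[OF p] by (metis coprime_common_divisor_int int_dvd_int_iff
        of_nat_1 of_nat_dvd_iff nat_dvd_1_iff_1 less_irrefl snd_conv zdvd1_eq abs_of_nat)
  then have a: "a \<noteq> 0" by auto
  have "\<not> is_unit (int p)" using prime_gt_1_nat[OF p] by simp
  then have "multiplicity (int p) b \<ge> 1"
    using dvd ab b multiplicity_geI[of b "int p" 1] by simp
  then have "real p powi (int (multiplicity (int p) b)) > 1"
    using prime_gt_1_nat[OF p] by simp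
  then show False
    using q a na by (simp add: padic_abs_def ab not_dvd_imp_multiplicity_0)
qed

text \<open>
  Division by an entry of maximal absolute value makes all entries $p$-integral and one of them equal
  to $1$. Their denominators are then prime to $p$, and so is the product of these denominators, by
  which the entries may be multiplied.
\<close>

lemma primitive_integral_multiple:
  fixes f :: "'a \<Rightarrow> rat"
  assumes p: "prime p" and A: "finite A" and ne: "x0 \<in> A" "f x0 \<noteq> 0"
  shows "\<exists>c b. (\<forall>x\<in>A. c * f x = of_int (b x)) \<and> (\<exists>x\<in>A. \<not> int p dvd b x)"
proof -
  have "Max ((\<lambda>x. padic_abs p (f x)) ` A) \<in> (\<lambda>x. padic_abs p (f x)) ` A"
    using A ne(1) by (intro Max_in) auto
  then obtain x1 where x1: "x1 \<in> A"
    and Max: "Max ((\<lambda>x. padic_abs p (f x)) ` A) = padic_abs p (f x1)" by auto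
  have max: "padic_abs p (f x) \<le> padic_abs p (f x1)" if "x \<in> A" for x
    unfolding Max[symmetric] using A that by (intro Max_ge) auto
  have "padic_abs p (f x1) > 0"
    using max[OF ne(1)] padic_abs_pos[OF p ne(2)] by simp
  then have f1: "f x1 \<noteq> 0" and pos: "padic_abs p (f x1) > 0" by auto
  define g where "g x = f x / f x1" for x
  define num den where "num x = fst (quotient_of (g x))" and "den x = snd (quotient_of (g x))" for x
  have g: "g x * of_int (den x) = of_int (num x)" for x
  proof -
    have q: "quotient_of (g x) = (num x, den x)" by (simp add: num_def den_def)
    then show ?thesis
      using quotient_of_div[OF q] quotient_of_denom_pos[OF q] by simp
  qed
  have "padic_abs p (g x) \<le> 1" if "x \<in> A" for x
  proof -
    have "padic_abs p (g x) * padic_abs p (f x1) \<le> 1 * padic_abs p (f x1)"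
      using max[OF that] f1 by (simp add: g_def flip: padic_abs_mult[OF p])
    then show ?thesis using pos by (simp only: mult_le_cancel_right_pos)
  qed
  then have nd: "\<not> int p dvd den x" if "x \<in> A" for x
    using that denominator_coprime_if_padic_abs_le_1[OF p] by (simp add: den_def)
  define d where "d = (\<Prod>x\<in>A. den x)"
  have "\<not> int p dvd d" using nd A p by (auto simp: d_def prime_dvd_prod_iff)
  define b where "b x = num x * (\<Prod>y\<in>A - {x}. den y)" for x
  have b: "of_int d / f x1 * f x = of_int (b x)" if x: "x \<in> A" for x
  proof -
    have "of_int d / f x1 * f x = g x * of_int d" by (simp add: g_def)
    also have "\<dots> = g x * of_int (den x * (\<Prod>y\<in>A - {x}. den y))"
      using A x by (simp add: d_def prod.remove)
    also have "\<dots> = of_int (b x)"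
      using g[of x] by (simp add: b_def flip: mult.assoc)
    finally show ?thesis .
  qed
  have "of_int (b x1) = (of_int d :: rat)" using b[OF x1] f1 by simp
  then have "b x1 = d" by (simp only: of_int_eq_iff)
  then show ?thesis using b x1 \<open>\<not> int p dvd d\<close> by blast
qed

section \<open>Representing p-adic numbers by Cauchy sequences\<close>

definition padic_of :: "nat \<Rightarrow> (nat \<Rightarrow> rat) \<Rightarrow> padic" where
  "padic_of p X = {X. padic_null p X} +>\<^bsub>padic_Cauchy_ring p\<^esub> X"

lemma padic_of_ring_hom:
  assumes p: "prime p"
  shows "ring_hom_cring (padic_Cauchy_ring p) (padic_field p) (padic_of p)"
  using ideal.rcos_ring_hom_cring[OF padic_null_ideal[OF p] padic_Cauchy_ring_cring[OF p]]
  unfolding padic_field_def padic_of_def .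

lemma padic_of_surj:
  assumes "x \<in> carrier (padic_field p)"
  shows "\<exists>X. padic_Cauchy p X \<and> x = padic_of p X"
  using assms
  by (auto simp: padic_field_def padic_of_def FactRing_def A_RCOSETS_def' padic_Cauchy_ring_def)

lemma padic_of_eq_zero_iff:
  assumes p: "prime p" and X: "padic_Cauchy p X"
  shows "padic_of p X = \<zero>\<^bsub>padic_field p\<^esub> \<longleftrightarrow> padic_null p X"
proof -
  interpret I: ideal "{X. padic_null p X}" "padic_Cauchy_ring p" by (rule padic_null_ideal[OF p])
  have X': "X \<in> carrier (padic_Cauchy_ring p)" using X by (simp add: padic_Cauchy_ring_def)
  show ?thesis
    using I.rcos_const_imp_mem[OF X'] I.a_rcos_const[of X]
    by (auto simp: padic_field_def padic_of_def FactRing_def)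
qed

lemma padic_of_power:
  assumes p: "prime p" and X: "padic_Cauchy p X"
  shows "padic_Cauchy p (\<lambda>n. X n ^ k)"
    and "padic_of p X [^]\<^bsub>padic_field p\<^esub> k = padic_of p (\<lambda>n. X n ^ k)"
proof -
  interpret ring_hom_cring "padic_Cauchy_ring p" "padic_field p" "padic_of p"
    by (rule padic_of_ring_hom[OF p])
  show C: "padic_Cauchy p (\<lambda>n. X n ^ k)" for k
    by (induction k) (simp_all add: padic_Cauchy_const padic_Cauchy_mult[OF p X])
  show "padic_of p X [^]\<^bsub>padic_field p\<^esub> k = padic_of p (\<lambda>n. X n ^ k)"
  proof (induction k)
    case 0
    show ?case using hom_one by (simp add: padic_Cauchy_ring_def)
  next
    case (Suc k)
    then show ?case
      using hom_mult[of "\<lambda>n. X n ^ k" X] C[of k] X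
      by (simp add: padic_Cauchy_ring_def mult.commute)
  qed
qed

lemma padic_of_nat_multiple:
  fixes k :: nat
  assumes p: "prime p" and X: "padic_Cauchy p X"
  shows "padic_Cauchy p (\<lambda>n. of_nat k * X n)"
    and "[k] \<cdot>\<^bsub>padic_field p\<^esub> padic_of p X = padic_of p (\<lambda>n. of_nat k * X n)"
proof -
  interpret ring_hom_cring "padic_Cauchy_ring p" "padic_field p" "padic_of p"
    by (rule padic_of_ring_hom[OF p])
  show C: "padic_Cauchy p (\<lambda>n. of_nat k * X n)" for k :: nat
    by (intro padic_Cauchy_mult p padic_Cauchy_const X)
  show "[k] \<cdot>\<^bsub>padic_field p\<^esub> padic_of p X = padic_of p (\<lambda>n. of_nat k * X n)"
  proof (induction k)
    case 0
    show ?case using hom_zero by (simp add: padic_Cauchy_ring_def)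
  next
    case (Suc k)
    then show ?case
      using hom_add[of "\<lambda>n. of_nat k * X n" X] C[of k] X
      by (simp add: padic_Cauchy_ring_def algebra_simps)
  qed
qed

lemma padic_of_sum:
  assumes p: "prime p" and A: "finite A" and X: "\<And>i. i \<in> A \<Longrightarrow> padic_Cauchy p (X i)"
  shows "padic_Cauchy p (\<lambda>n. \<Sum>i\<in>A. X i n)"
    and "(\<Oplus>\<^bsub>padic_field p\<^esub>i\<in>A. padic_of p (X i)) = padic_of p (\<lambda>n. \<Sum>i\<in>A. X i n)"
proof -
  interpret ring_hom_cring "padic_Cauchy_ring p" "padic_field p" "padic_of p"
    by (rule padic_of_ring_hom[OF p])
  have "padic_Cauchy p (\<lambda>n. \<Sum>i\<in>A. X i n) \<and>
      (\<Oplus>\<^bsub>padic_field p\<^esub>i\<in>A. padic_of p (X i)) = padic_of p (\<lambda>n. \<Sum>i\<in>A. X i n)"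
    using A X
  proof (induction A rule: finite_induct)
    case empty
    show ?case using hom_zero by (simp add: padic_Cauchy_ring_def padic_Cauchy_const)
  next
    case (insert i A)
    have closed: "padic_of p Y \<in> carrier (padic_field p)" if "padic_Cauchy p Y" for Y
      using that hom_closed by (simp add: padic_Cauchy_ring_def)
    have "padic_of p (X i) \<oplus>\<^bsub>padic_field p\<^esub> padic_of p (\<lambda>n. \<Sum>i\<in>A. X i n)
        = padic_of p (\<lambda>n. X i n + (\<Sum>i\<in>A. X i n))"
      using hom_add[of "X i" "\<lambda>n. \<Sum>i\<in>A. X i n"] insert
      by (simp add: padic_Cauchy_ring_def)
    then show ?case
      using insert by (simp add: closed padic_Cauchy_add[OF p] S.finsum_insert Pi_def)
  qed
  then show "padic_Cauchy p (\<lambda>n. \<Sum>i\<in>A. X i n)"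
    and "(\<Oplus>\<^bsub>padic_field p\<^esub>i\<in>A. padic_of p (X i)) = padic_of p (\<lambda>n. \<Sum>i\<in>A. X i n)"
    by blast+
qed

section \<open>Systems of equations over the p-adic numbers\<close>

text \<open>
  Here $Q_m$ stands for any function that is homogeneous of degree $\delta_m$ and depends only on the
  coordinates in $A$. Evaluation of the sequences at one late index gives rationals $z_x$ with
  $|z_{x_0}| \ge d$ and $|Q_m(z)|$ as small as desired. If $c z$ is integral, then
  $|c| d \le |c z_{x_0}| \le 1$, so the rescaling costs at most the factor $d^{-\delta_m}$, whatever
  index has been chosen.
\<close>

lemma primitive_integral_approximate_solution:
  fixes X :: "'i \<Rightarrow> nat \<Rightarrow> rat" and Q :: "nat \<Rightarrow> ('i \<Rightarrow> rat) \<Rightarrow> rat"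
  assumes p: "prime p" and A: "finite A" and S: "finite S"
    and X: "x0 \<in> A" "padic_Cauchy p (X x0)" "\<not> padic_null p (X x0)"
    and hom: "\<And>m c z. m \<in> S \<Longrightarrow> Q m (\<lambda>x. c * z x) = c ^ \<delta> m * Q m z"
    and loc: "\<And>m z z'. m \<in> S \<Longrightarrow> (\<And>x. x \<in> A \<Longrightarrow> z x = z' x) \<Longrightarrow> Q m z = Q m z'"
    and null: "\<And>m. m \<in> S \<Longrightarrow> padic_null p (\<lambda>n. Q m (\<lambda>x. X x n))"
  shows "\<exists>b. (\<exists>x\<in>A. \<not> int p dvd b x) \<and>
    (\<forall>m\<in>S. padic_abs p (Q m (\<lambda>x. of_int (b x))) \<le> real p powi (- int N))"
proof -
  obtain d K0 where d: "d > 0" and K0: "\<And>n. n \<ge> K0 \<Longrightarrow> padic_abs p (X x0 n) \<ge> d"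
    using padic_Cauchy_not_null[OF p X(2,3)] by metis
  \<comment> \<open>The factor \<open>d ^ \<delta> m\<close> anticipates the loss in the later rescaling by \<open>c\<close>.\<close>
  define e where "e m = real p powi (- int N) * d ^ \<delta> m" for m
  have e: "e m > 0" for m
    using d prime_gt_0_nat[OF p] by (simp add: e_def)
  have "\<forall>\<^sub>F n in sequentially. \<forall>m\<in>S. padic_abs p (Q m (\<lambda>x. X x n)) < e m"
    using S null e by (intro eventually_ball_finite)
      (auto simp: padic_null_def eventually_sequentially)
  then obtain K1 where K1: "\<forall>n\<ge>K1. \<forall>m\<in>S. padic_abs p (Q m (\<lambda>x. X x n)) < e m"
    by (auto simp: eventually_sequentially)
  define n where "n = max K0 K1"
  define z where "z x = X x n" for x
  have z0: "padic_abs p (z x0) \<ge> d" using K0[of n] by (simp add: z_def n_def)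
  have Qz: "padic_abs p (Q m z) < e m" if "m \<in> S" for m
    using K1 that by (simp add: z_def[abs_def] n_def)
  have "z x0 \<noteq> 0" using z0 d by auto
  then obtain c b where cb: "\<And>x. x \<in> A \<Longrightarrow> c * z x = of_int (b x)" and prim: "\<exists>x\<in>A. \<not> int p dvd b x"
    using primitive_integral_multiple[OF p A X(1), of z] by metis
  have "padic_abs p c * d \<le> padic_abs p c * padic_abs p (z x0)"
    using z0 by (intro mult_left_mono padic_abs_nonneg[OF p])
  also have "\<dots> = padic_abs p (of_int (b x0))"
    using cb[OF X(1)] by (simp flip: padic_abs_mult[OF p])
  also have "\<dots> \<le> 1"
    using prime_power_dvd_iff_padic_abs_le[OF p, of 0 "b x0"] by simp
  finally have cd: "padic_abs p c * d \<le> 1" .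
  have "padic_abs p (Q m (\<lambda>x. of_int (b x))) \<le> real p powi (- int N)" if m: "m \<in> S" for m
  proof -
    have "Q m (\<lambda>x. of_int (b x)) = Q m (\<lambda>x. c * z x)"
      using cb by (intro loc[OF m]) simp
    also have "padic_abs p \<dots> = padic_abs p c ^ \<delta> m * padic_abs p (Q m z)"
      by (simp add: hom[OF m] padic_abs_mult[OF p] padic_abs_power[OF p])
    also have "\<dots> \<le> padic_abs p c ^ \<delta> m * e m"
      using Qz[OF m] padic_abs_nonneg[OF p, of c] by (intro mult_left_mono) auto
    also have "\<dots> = real p powi (- int N) * (padic_abs p c * d) ^ \<delta> m"
      by (simp add: e_def power_mult_distrib)
    also have "\<dots> \<le> real p powi (- int N) * 1"
      using cd d padic_abs_nonneg[OF p, of c] by (intro mult_left_mono power_le_one) auto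
    finally show ?thesis by simp
  qed
  then show ?thesis using prim by blast
qed

theorem theorem1p2:
  fixes p h M r s W :: nat
    and \<M> :: "nat set"
    and x :: "nat \<Rightarrow> nat \<Rightarrow> padic"
  assumes "prime p" and "h \<ge> 1" and "p = 2 \<Longrightarrow> h \<ge> 3"
    and "M \<ge> 1" and "\<M> \<subseteq> {M..<2 * M}" and "card \<M> = r"
    and "W = totient (p ^ h) div (h + 1)"
    and "s \<ge> 1"
    and "\<And>i l. i \<in> {1..s} \<Longrightarrow> l \<in> {..<W} \<Longrightarrow> x i l \<in> carrier (padic_field p)"
    and "\<exists>i\<in>{1..s}. \<exists>l\<in>{..<W}. x i l \<noteq> \<zero>\<^bsub>padic_field p\<^esub>"
    and "\<And>m. m \<in> \<M> \<Longrightarrow>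
      (\<Oplus>\<^bsub>padic_field p\<^esub>l\<in>{..<W}.
         [(p ^ (l * (h + 1) * M))] \<cdot>\<^bsub>padic_field p\<^esub>
           diag_form (padic_field p) p h m s (\<lambda>i. x i l)) = \<zero>\<^bsub>padic_field p\<^esub>"
  shows "s \<ge> p ^ (r * h)"
proof -
  note p = \<open>prime p\<close>
  let ?F = "padic_field p"
  define A where "A = {1..s} \<times> {..<W}"
  have "\<exists>Y. padic_Cauchy p Y \<and> x (fst j) (snd j) = padic_of p Y" if "j \<in> A" for j
    using padic_of_surj[OF assms(9)[of "fst j" "snd j"]] that by (auto simp: A_def)
  then obtain X where X: "\<And>j. j \<in> A \<Longrightarrow> padic_Cauchy p (X j) \<and> x (fst j) (snd j) = padic_of p (X j)"
    by metis
  have XC: "padic_Cauchy p (X (i, l))" and Xx: "x i l = padic_of p (X (i, l))" if "(i, l) \<in> A" for i l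
    using X[OF that] by auto
  define Q :: "nat \<Rightarrow> (nat \<times> nat \<Rightarrow> rat) \<Rightarrow> rat" where
    "Q m z = (\<Sum>l<W. of_nat (p ^ (l * (h + 1) * M)) *
      (\<Sum>i\<in>{1..s}. z (i, l) ^ (totient (p ^ h) * m)))" for m z
  have null: "padic_null p (\<lambda>n. Q m (\<lambda>j. X j n))" if m: "m \<in> \<M>" for m
  proof -
    interpret ring_hom_cring "padic_Cauchy_ring p" ?F "padic_of p"
      by (rule padic_of_ring_hom[OF p])
    let ?k = "totient (p ^ h) * m"
    have closed: "padic_of p Y \<in> carrier ?F" if "padic_Cauchy p Y" for Y
      using that hom_closed by (simp add: padic_Cauchy_ring_def)
    have C1: "padic_Cauchy p (\<lambda>n. \<Sum>i\<in>{1..s}. X (i, l) n ^ ?k)" if "l \<in> {..<W}" for l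
      using that by (intro padic_of_sum p padic_of_power XC) (auto simp: A_def)
    have form: "diag_form ?F p h m s (\<lambda>i. x i l) = padic_of p (\<lambda>n. \<Sum>i\<in>{1..s}. X (i, l) n ^ ?k)"
      if l: "l \<in> {..<W}" for l
    proof -
      have "diag_form ?F p h m s (\<lambda>i. x i l)
          = (\<Oplus>\<^bsub>?F\<^esub>i\<in>{1..s}. padic_of p (\<lambda>n. X (i, l) n ^ ?k))"
        unfolding diag_form_def using l
        by (intro S.finsum_cong' refl)
          (auto simp: Xx XC A_def padic_of_power[OF p] closed)
      also have "\<dots> = padic_of p (\<lambda>n. \<Sum>i\<in>{1..s}. X (i, l) n ^ ?k)"
        using l by (intro padic_of_sum p padic_of_power XC) (auto simp: A_def)
      finally show ?thesis .
    qed
    have C2: "padic_Cauchy p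
        (\<lambda>n. of_nat (p ^ (l * (h + 1) * M)) * (\<Sum>i\<in>{1..s}. X (i, l) n ^ ?k))" if "l \<in> {..<W}" for l
      by (rule padic_of_nat_multiple(1)[OF p C1[OF that]])
    have multiple: "[(p ^ (l * (h + 1) * M))] \<cdot>\<^bsub>?F\<^esub> diag_form ?F p h m s (\<lambda>i. x i l) = padic_of p
        (\<lambda>n. of_nat (p ^ (l * (h + 1) * M)) * (\<Sum>i\<in>{1..s}. X (i, l) n ^ ?k))"
      if "l \<in> {..<W}" for l
      unfolding form[OF that] by (rule padic_of_nat_multiple(2)[OF p C1[OF that]])
    have "\<zero>\<^bsub>?F\<^esub> = (\<Oplus>\<^bsub>?F\<^esub>l\<in>{..<W}. padic_of p
        (\<lambda>n. of_nat (p ^ (l * (h + 1) * M)) * (\<Sum>i\<in>{1..s}. X (i, l) n ^ ?k)))"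
      unfolding assms(11)[OF m, symmetric]
      using closed[OF C2] by (intro S.finsum_cong' refl multiple) blast
    also have "\<dots> = padic_of p (\<lambda>n. Q m (\<lambda>j. X j n))"
      unfolding Q_def by (intro padic_of_sum p C2) auto
    finally have "padic_of p (\<lambda>n. Q m (\<lambda>j. X j n)) = \<zero>\<^bsub>?F\<^esub>" ..
    moreover have "padic_Cauchy p (\<lambda>n. Q m (\<lambda>j. X j n))"
      unfolding Q_def by (intro padic_of_sum p C2) auto
    ultimately show ?thesis using padic_of_eq_zero_iff[OF p] by blast
  qed
  obtain i0 l0 where j0: "(i0, l0) \<in> A" "x i0 l0 \<noteq> \<zero>\<^bsub>?F\<^esub>"
    using assms(10) unfolding A_def by blast
  have nn: "\<not> padic_null p (X (i0, l0))"
    using j0 Xx[OF j0(1)] padic_of_eq_zero_iff[OF p XC[OF j0(1)]] by simp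
  have "\<exists>b. (\<exists>j\<in>A. \<not> int p dvd b j) \<and>
    (\<forall>m\<in>\<M>. padic_abs p (Q m (\<lambda>j. of_int (b j))) \<le> real p powi (- int (W * (h + 1) * M)))"
  proof (rule primitive_integral_approximate_solution[where X = X and Q = Q and ?x0.0 = "(i0, l0)"
        and \<delta> = "\<lambda>m. totient (p ^ h) * m"])
    show "finite A" by (simp add: A_def)
    show "finite \<M>" using assms(5) finite_subset by blast
    show "Q m (\<lambda>j. c * z j) = c ^ (totient (p ^ h) * m) * Q m z" for m c z
      by (simp add: Q_def power_mult_distrib sum_distrib_left mult_ac)
    show "Q m z = Q m z'" if "\<And>j. j \<in> A \<Longrightarrow> z j = z' j" for m z z'
      using that unfolding Q_def by (intro sum.cong arg_cong2[where f = "(*)"] refl) (auto simp: A_def)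
  qed (fact p j0(1) XC[OF j0(1)] nn null)+
  then obtain b where prim: "\<exists>j\<in>A. \<not> int p dvd b j"
    and b: "\<And>m. m \<in> \<M> \<Longrightarrow> padic_abs p (Q m (\<lambda>j. of_int (b j))) \<le> real p powi (- int (W * (h + 1) * M))"
    by blast
  obtain i l where il: "i \<in> {1..s}" "l < W" "\<not> int p dvd b (i, l)"
    using prim by (auto simp: A_def)
  have "p ^ (card \<M> * h) \<le> s"
  proof (rule le_number_of_variables_if_primitive_solution[where b = "\<lambda>i l. b (i, l)", OF p assms(2) _ assms(5) _ il])
    show "h \<ge> 2" if "p = 2" using assms(3)[OF that] by simp
    show "W * (h + 1) \<le> totient (p ^ h)" unfolding assms(7) by (rule div_times_less_eq_dividend)
    fix m assume "m \<in> \<M>"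
    then show "int p ^ (W * (h + 1) * M) dvd (\<Sum>l<W. int p ^ (l * (h + 1) * M) *
        (\<Sum>i\<in>{1..s}. b (i, l) ^ (totient (p ^ h) * m)))"
      unfolding prime_power_dvd_iff_padic_abs_le[OF p] using b[of m] by (simp add: Q_def)
  qed
  then show ?thesis using assms(6) by simp
qed

end
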